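(* Let $\alpha>-1$, $\beta>0$, and let $\varphi,\psi$ be nonnegative functions defined on $\mathbb{R}_+=(0,\infty)$ which are related by $$\varphi(t)=\frac1t\int_0^\infty e^{-x/t}\psi(x)\,dx .$$ Assume that $$\int_0^\infty x^ke^{-x}\psi(x)\,dx<\infty\quad\text{for all }k\in\mathbb{N}_0 .$$ Let $\{P_n\}_{n\ge0}$ be the sequence of orthogonal polynomials with respect to the measure $e^{-x}U(1+\alpha,1-\beta,x)\psi(x)\,dx$ over $\mathbb{R}_+$, normalized so that the second equality below holds. Then $\{P_n\}_{n\ge0}$ is compositionally orthogonal in the sense of Jacobi relatively to the function $\varphi$, i.e. for all $n,m\in\mathbb{N}_0$ $$\int_0^1P_n(\theta)P_m(\theta)\{\varphi(t)\}\,(1-t)^\alpha t^\beta\,dt=\Gamma(1+\alpha)\int_0^\infty P_n(x)P_m(x)\,e^{-x}U(1+\alpha,1-\beta,x)\psi(x)\,dx=\delta_{n,m}.$$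
   Context: $\theta=tDt$ with $D=d/dt$, i.e. $\theta\{f\}(t)=t\frac{d}{dt}\big(tf(t)\big)$; for a polynomial $P(x)=\sum_kp_kx^k$, $P(\theta)=\sum_kp_k\theta^k$. $U(a,b,z)$ is the Tricomi confluent hypergeometric function; for $a>0$, $z>0$, $U(a,b,z)=\frac1{\Gamma(a)}\int_0^\infty e^{-zt}t^{a-1}(1+t)^{b-a-1}\,dt$. Here $P_n$ is a real polynomial of degree $n$, and $\delta_{n,m}$ is the Kronecker symbol. *)

theory Defs
  imports "HOL-Analysis.Analysis" "HOL-Computational_Algebra.Polynomial"
begin

text \<open>
  Tricomi's confluent hypergeometric function through its Laplace integral;
  this represents the function only for \<open>a > 0\<close> and \<open>z > 0\<close>.
\<close>

definition tricomi_U :: "real \<Rightarrow> real \<Rightarrow> real \<Rightarrow> real" where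
  "tricomi_U a b z =
     1 / Gamma a *
     (LINT t:{0<..}|lebesgue. exp (- z * t) * t powr (a - 1) * (1 + t) powr (b - a - 1))"

definition theta :: "(real \<Rightarrow> real) \<Rightarrow> (real \<Rightarrow> real)" where
  "theta f = (\<lambda>t. t * deriv (\<lambda>s. s * f s) t)"

definition poly_theta :: "real poly \<Rightarrow> (real \<Rightarrow> real) \<Rightarrow> (real \<Rightarrow> real)" where
  "poly_theta p f = (\<lambda>t. \<Sum>k\<le>degree p. coeff p k * (theta ^^ k) f t)"

definition weighted_measure :: "(real \<Rightarrow> real) \<Rightarrow> real measure" where
  "weighted_measure w = density (restrict_space lebesgue {0<..}) (\<lambda>x. ennreal (w x))"

text \<open>
  The condition \<open>P n \<noteq> 0\<close> only matters for \<open>n = 0\<close>, since \<open>degree 0 = 0\<close>.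
  Integrability of the products is deliberately not demanded: the definition is meant for
  measures with finite moments.
\<close>

definition orthogonal_polynomials :: "real measure \<Rightarrow> (nat \<Rightarrow> real poly) \<Rightarrow> bool" where
  "orthogonal_polynomials M P \<longleftrightarrow>
     (\<forall>n. P n \<noteq> 0 \<and> degree (P n) = n) \<and>
     (\<forall>n m. n \<noteq> m \<longrightarrow> (LINT x|M. poly (P n) x * poly (P m) x) = 0)"

end

theory Submission imports Defs begin

text \<open>
  The operator \<open>\<theta>\<close> sends \<open>t \<mapsto> 1/t \<integral> e\<^bsup>-x/t\<^esup> g(x) dx\<close> to the same expression with \<open>x g(x)\<close> in place of
  \<open>g(x)\<close>, since the derivative of \<open>e\<^bsup>-x/t\<^esup>\<close> in \<open>t\<close> is \<open>x/t\<^sup>2 e\<^bsup>-x/t\<^esup>\<close>. Hence on \<open>(0,1)\<close> the function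
  \<open>P(\<theta>){\<phi>}\<close> is the transform of \<open>P \<psi>\<close>. Integrating against \<open>(1-t)\<^sup>\<alpha> t\<^sup>\<beta>\<close> and exchanging the integrals, which
  is allowed because \<open>e\<^bsup>-x/t\<^esup> \<le> e\<^bsup>-x\<^esup>\<close> for \<open>t \<le> 1\<close>, leaves an inner integral over \<open>t\<close> that the substitution
  \<open>t = 1/(1+s)\<close> turns into \<open>\<Gamma>(1+\<alpha>) e\<^bsup>-x\<^esup> U(1+\<alpha>,1-\<beta>,x)\<close>.
\<close>

section \<open>Differentiating the Laplace integral in t under the integral sign\<close>

text \<open>Mean value inequality: the u-derivative of e^(-x/u) is largest in each factor at u = r
  and u = 1 respectively. The constant keeps the decay e^(-x), so the difference quotients in t get
  a majorant in x whose only cost is one extra power of x.\<close>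

lemma exp_neg_div_lipschitz:
  fixes x s t r :: real
  assumes "0 < x" "0 < r" "s \<in> {r..1}" "t \<in> {r..1}"
  shows "\<bar>exp (- x / s) - exp (- x / t)\<bar> \<le> x / r\<^sup>2 * exp (- x) * \<bar>s - t\<bar>"
proof -
  have der: "((\<lambda>u. exp (- x / u)) has_field_derivative x / u\<^sup>2 * exp (- x / u)) (at u within {r..1})"
    if "u \<in> {r..1}" for u
    using that assms by (auto intro!: derivative_eq_intros simp: power2_eq_square)
  have bound: "norm (x / u\<^sup>2 * exp (- x / u)) \<le> x / r\<^sup>2 * exp (- x)" if "u \<in> {r..1}" for u
  proof -
    have "x / u\<^sup>2 \<le> x / r\<^sup>2"
      using that assms by (intro divide_left_mono power_mono mult_pos_pos zero_less_power) auto
    moreover have "exp (- x / u) \<le> exp (- x)"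
      using that assms by (simp add: field_simps)
    ultimately have "x / u\<^sup>2 * exp (- x / u) \<le> x / r\<^sup>2 * exp (- x)"
      using assms by (intro mult_mono) auto
    then show ?thesis
      using assms by (simp add: abs_mult)
  qed
  show ?thesis
    using field_differentiable_bound[OF _ der bound \<open>s \<in> _\<close> \<open>t \<in> _\<close>] by simp
qed

text \<open>Multiplying by e^x undoes the weight, so integrability of the weighted function yields
  measurability of \<open>f\<close> on \<open>A\<close> itself.\<close>

lemma laplace_borel_measurable:
  fixes f :: "real \<Rightarrow> real"
  assumes "set_integrable lebesgue A (\<lambda>x. exp (- x) * f x)"
  shows "(\<lambda>x. indicator A x * f x) \<in> borel_measurable lebesgue"
proof -
  have "(\<lambda>x. indicator A x * (exp (- x) * f x)) \<in> borel_measurable lebesgue"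
    using assms by (auto simp: set_integrable_def)
  then have "(\<lambda>x. exp x * (indicator A x * (exp (- x) * f x))) \<in> borel_measurable lebesgue"
    by (rule borel_measurable_times[rotated]) (auto intro!: measurable_completion)
  also have "(\<lambda>x. exp x * (indicator A x * (exp (- x) * f x))) = (\<lambda>x. indicator A x * f x)"
    by (auto simp: exp_minus fun_eq_iff)
  finally show ?thesis .
qed

text \<open>For t > 1 the kernel e^(-x/t) decays more slowly than e^(-x) and the hypothesis gives no
  bound; this is why the whole argument stays within (0,1].\<close>

lemma laplace_integrable:
  fixes f :: "real \<Rightarrow> real"
  assumes f: "set_integrable lebesgue {0<..} (\<lambda>x. exp (- x) * f x)" and t: "0 < t" "t \<le> 1"
  shows "set_integrable lebesgue {0<..} (\<lambda>x. exp (- x / t) * f x)"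
proof (rule set_integrable_bound[OF f])
  have "(\<lambda>x. exp (- x / t) * (indicator {0<..} x * f x)) \<in> borel_measurable lebesgue"
    by (intro borel_measurable_times laplace_borel_measurable f measurable_completion) auto
  then show "set_borel_measurable lebesgue {0<..} (\<lambda>x. exp (- x / t) * f x)"
    by (simp add: set_borel_measurable_def mult_ac)
  have "exp (- x / t) \<le> exp (- x)" if "0 < x" for x
    using t that by (simp add: field_simps)
  then show "AE x in lebesgue. x \<in> {0<..} \<longrightarrow> norm (exp (- x / t) * f x) \<le> norm (exp (- x) * f x)"
    by (auto simp: abs_mult intro!: mult_right_mono)
qed

lemma laplace_has_field_derivative:
  fixes f :: "real \<Rightarrow> real"
  assumes f: "set_integrable lebesgue {0<..} (\<lambda>x. exp (- x) * f x)"
    and xf: "set_integrable lebesgue {0<..} (\<lambda>x. exp (- x) * (x * f x))"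
    and t: "0 < t" "t < 1"
  shows "((\<lambda>s. LINT x:{0<..}|lebesgue. exp (- x / s) * f x) has_field_derivative
           1 / t\<^sup>2 * (LINT x:{0<..}|lebesgue. exp (- x / t) * (x * f x))) (at t)"
  unfolding has_field_derivative_iff tendsto_at_iff_sequentially
proof (intro allI impI)
  fix X assume X: "\<forall>i. X i \<in> UNIV - {t}" and lim: "X \<longlonglongrightarrow> t"
  let ?F = "\<lambda>s. LINT x:{0<..}|lebesgue. exp (- x / s) * f x"
  let ?q = "\<lambda>i x. indicator {0<..} x * ((exp (- x / X i) - exp (- x / t)) / (X i - t) * f x)"
  let ?d = "\<lambda>x. indicator {0<..} x * (x / t\<^sup>2 * exp (- x / t) * f x)"
  \<comment> \<open>The lower bound t/2 will serve as r in the Lipschitz estimate; the upper bound 1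
    keeps e^(-x) as majorant. Since dominated convergence wants its bound at every index, the
    sequence is shifted by \<open>N\<close>.\<close>
  have "eventually (\<lambda>i. t / 2 < X i \<and> X i < 1) sequentially"
    using t by (intro eventually_conj order_tendstoD[OF lim]) auto
  then obtain N where N: "\<And>i. N \<le> i \<Longrightarrow> t / 2 < X i \<and> X i < 1"
    by (auto simp: eventually_sequentially)
  have meas: "(\<lambda>x. indicator {0<..} x * f x) \<in> borel_measurable lebesgue"
    by (rule laplace_borel_measurable[OF f])
  have "(\<lambda>i. integral\<^sup>L lebesgue (?q (i + N))) \<longlonglongrightarrow> integral\<^sup>L lebesgue ?d"
  proof (rule integral_dominated_convergence)
    have "(\<lambda>x. (x / t\<^sup>2 * exp (- x / t)) * (indicator {0<..} x * f x)) \<in> borel_measurable lebesgue"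
      by (intro borel_measurable_times[OF _ meas] measurable_completion) auto
    then show "?d \<in> borel_measurable lebesgue" by (simp add: mult_ac)
    show "?q (i + N) \<in> borel_measurable lebesgue" for i
    proof -
      have "(\<lambda>x. ((exp (- x / X (i + N)) - exp (- x / t)) / (X (i + N) - t)) * (indicator {0<..} x * f x))
          \<in> borel_measurable lebesgue"
        by (intro borel_measurable_times[OF _ meas] measurable_completion) auto
      then show ?thesis by (simp add: mult_ac)
    qed
    \<comment> \<open>The factor 4 / t^2 is 1 / r^2 for r = t/2.\<close>
    show "integrable lebesgue (\<lambda>x. 4 / t\<^sup>2 * \<bar>indicator {0<..} x * (exp (- x) * (x * f x))\<bar>)"
      using xf by (auto simp: set_integrable_def)
    show "AE x in lebesgue. (\<lambda>i. ?q (i + N) x) \<longlonglongrightarrow> ?d x"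
    proof (rule AE_I2)
      fix x :: real
      have "((\<lambda>s. exp (- x / s)) has_field_derivative x / t\<^sup>2 * exp (- x / t)) (at t)"
        using t by (auto intro!: derivative_eq_intros simp: power2_eq_square)
      then have "(\<lambda>i. (exp (- x / X i) - exp (- x / t)) / (X i - t)) \<longlonglongrightarrow> x / t\<^sup>2 * exp (- x / t)"
        using X lim unfolding has_field_derivative_iff tendsto_at_iff_sequentially o_def by blast
      then have "(\<lambda>i. ?q i x) \<longlonglongrightarrow> ?d x"
        by (intro tendsto_intros)
      then show "(\<lambda>i. ?q (i + N) x) \<longlonglongrightarrow> ?d x"
        by (rule LIMSEQ_ignore_initial_segment)
    qed
    show "AE x in lebesgue. norm (?q (i + N) x) \<le> 4 / t\<^sup>2 * \<bar>indicator {0<..} x * (exp (- x) * (x * f x))\<bar>" for i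
    proof (rule AE_I2)
      fix x :: real
      let ?s = "X (i + N)"
      have s: "t / 2 < ?s" "?s < 1" "?s \<noteq> t" using N[of "i + N"] X by auto
      show "norm (?q (i + N) x) \<le> 4 / t\<^sup>2 * \<bar>indicator {0<..} x * (exp (- x) * (x * f x))\<bar>"
      proof (cases "0 < x")
        case True
        have "\<bar>exp (- x / ?s) - exp (- x / t)\<bar> \<le> x / (t / 2)\<^sup>2 * exp (- x) * \<bar>?s - t\<bar>"
          using True s t by (intro exp_neg_div_lipschitz) auto
        then have "\<bar>(exp (- x / ?s) - exp (- x / t)) / (?s - t)\<bar> \<le> 4 / t\<^sup>2 * (x * exp (- x))"
          using s by (simp add: abs_divide divide_le_eq power_divide mult_ac)
        from mult_right_mono[OF this, of "\<bar>f x\<bar>"] show ?thesis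
          using True by (simp add: abs_mult mult_ac)
      qed simp
    qed
  qed
  then have q: "(\<lambda>i. integral\<^sup>L lebesgue (?q i)) \<longlonglongrightarrow> integral\<^sup>L lebesgue ?d"
    by (rule LIMSEQ_offset)
  have d: "integral\<^sup>L lebesgue ?d = 1 / t\<^sup>2 * (LINT x:{0<..}|lebesgue. exp (- x / t) * (x * f x))"
    unfolding set_lebesgue_integral_def
    by (subst integral_mult_right_zero[symmetric]) (auto intro!: Bochner_Integration.integral_cong)
  \<comment> \<open>Splitting the integral of the difference needs both integrals to converge, which
    is known once \<open>X i\<close> lies in (0,1].\<close>
  have ev: "eventually (\<lambda>i. integral\<^sup>L lebesgue (?q i) = (?F (X i) - ?F t) / (X i - t)) sequentially"
    using eventually_ge_at_top[of N]
  proof eventually_elim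
    case (elim i)
    then have s: "0 < X i" "X i \<le> 1" using N[of i] t by auto
    have diff: "?F (X i) - ?F t = (LINT x:{0<..}|lebesgue. exp (- x / X i) * f x - exp (- x / t) * f x)"
      using s t by (intro set_integral_diff(2)[symmetric] laplace_integrable f) auto
    show ?case
      unfolding diff unfolding set_lebesgue_integral_def integral_divide_zero[symmetric]
      by (rule Bochner_Integration.integral_cong) (simp_all add: diff_divide_distrib algebra_simps)
  qed
  show "((\<lambda>s. (?F s - ?F t) / (s - t)) \<circ> X) \<longlonglongrightarrow>
      1 / t\<^sup>2 * (LINT x:{0<..}|lebesgue. exp (- x / t) * (x * f x))"
    unfolding o_def d[symmetric] by (rule tendsto_cong[OF ev, THEN iffD1, OF q])
qed

section \<open>The Jacobi weight and Tricomi's function\<close>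

text \<open>Needed for Fubini. A countable Borel cover by sets of finite measure still works after
  completion.\<close>

lemma sigma_finite_lebesgue: "sigma_finite_measure (lebesgue :: real measure)"
proof
  obtain A :: "real set set" where "countable A" "A \<subseteq> sets lborel" "\<Union> A = space lborel"
      "\<forall>a\<in>A. emeasure lborel a \<noteq> \<infinity>"
    using lborel.sigma_finite_countable by blast
  then show "\<exists>A :: real set set. countable A \<and> A \<subseteq> sets lebesgue \<and> \<Union> A = space lebesgue \<and>
      (\<forall>a\<in>A. emeasure lebesgue a \<noteq> \<infinity>)"
    by (intro exI[of _ A]) auto
qed

text \<open>A Beta integral with positive parameters \<beta> and 1 + \<alpha>. The exponent is
  \<beta> - 1 because the prefactor 1/t of the transform takes one power from t^\<beta>.\<close>

lemma jacobi_weight_integrable: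
  fixes \<alpha> \<beta> :: real
  assumes "\<alpha> > -1" "\<beta> > 0"
  shows "set_integrable lebesgue {0<..<1} (\<lambda>t. (1 - t) powr \<alpha> * t powr (\<beta> - 1))"
proof (rule nonnegative_absolutely_integrable_1)
  have "((\<lambda>t. t powr (\<beta> - 1) * (1 - t) powr (1 + \<alpha> - 1)) has_integral Beta \<beta> (1 + \<alpha>)) {0<..<1}"
    using has_integral_Beta_real[of \<beta> "1 + \<alpha>"] assms by (simp add: has_integral_Icc_iff_Ioo)
  then show "(\<lambda>t. (1 - t) powr \<alpha> * t powr (\<beta> - 1)) integrable_on {0<..<1}"
    by (simp add: mult.commute has_integral_integrable)
qed auto

lemma tricomi_U_Jacobi_integral:
  fixes \<alpha> \<beta> x :: real
  assumes "\<alpha> > -1" "\<beta> > 0" "x > 0"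
  shows "(LINT t:{0<..<1}|lebesgue. (1 - t) powr \<alpha> * t powr (\<beta> - 1) * exp (- x / t)) =
    Gamma (1 + \<alpha>) * (exp (- x) * tricomi_U (1 + \<alpha>) (1 - \<beta>) x)"
proof -
  let ?f = "\<lambda>t. (1 - t) powr \<alpha> * t powr (\<beta> - 1) * exp (- x / t)"
  let ?g = "\<lambda>s::real. 1 / (1 + s)" and ?g' = "\<lambda>s::real. - 1 / (1 + s)\<^sup>2"
  let ?h = "\<lambda>s. exp (- x) * (exp (- x * s) * s powr (1 + \<alpha> - 1) * (1 + s) powr (1 - \<beta> - (1 + \<alpha>) - 1))"
  have img: "?g ` {0<..} = {0<..<1}"
  proof (intro equalityI subsetI)
    fix t :: real assume "t \<in> {0<..<1}"
    then show "t \<in> ?g ` {0<..}"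
      by (intro image_eqI[of _ _ "1 / t - 1"]) (auto simp: field_simps)
  qed auto
  have f: "set_integrable lebesgue {0<..<1} ?f"
  proof (rule set_integrable_bound[OF jacobi_weight_integrable[OF assms(1,2)]])
    show "set_borel_measurable lebesgue {0<..<1} ?f"
      unfolding set_borel_measurable_def by (intro measurable_completion) measurable
    show "AE t in lebesgue. t \<in> {0<..<1} \<longrightarrow> norm (?f t) \<le> norm ((1 - t) powr \<alpha> * t powr (\<beta> - 1))"
      using assms by (auto simp: abs_mult intro!: mult_left_le)
  qed
  have der: "(?g has_field_derivative ?g' s) (at s within {0<..})" if "s \<in> {0<..}" for s
    using that by (auto intro!: derivative_eq_intros simp: power2_eq_square field_simps)
  have inj: "inj_on ?g {0<..}" by (auto simp: inj_on_def)
  have subst: "\<bar>?g' s\<bar> * ?f (?g s) = ?h s" if "s \<in> {0<..}" for s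
  proof -
    have s: "s > 0" using that by simp
    have "1 - ?g s = s / (1 + s)" using s by (simp add: field_simps)
    moreover have "exp (- x / ?g s) = exp (- x) * exp (- x * s)"
      by (simp add: exp_add[symmetric] algebra_simps)
    moreover have "\<bar>?g' s\<bar> = (1 + s) powr (- 2)"
      using s by (simp add: powr_minus_divide powr_numeral)
    moreover have "?g s powr (\<beta> - 1) = (1 + s) powr (1 - \<beta>)"
      using s by (simp add: powr_divide powr_minus_divide[symmetric])
    moreover have "(s / (1 + s)) powr \<alpha> = s powr \<alpha> * (1 + s) powr (- \<alpha>)"
      using s by (simp add: powr_divide powr_minus_divide)
    \<comment> \<open>Collects the powers of 1 + s from the Jacobian, from 1 - t and from t; the sum
      is b - a - 1 for a = 1 + \<alpha>, b = 1 - \<beta>.\<close>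
    moreover have "(1 + s) powr (- 2) * ((1 + s) powr (- \<alpha>) * (1 + s) powr (1 - \<beta>)) =
        (1 + s) powr (1 - \<beta> - (1 + \<alpha>) - 1)"
      unfolding powr_add[symmetric] by (rule arg_cong[where f = "(powr) (1 + s)"]) simp
    ultimately show ?thesis by (simp add: mult_ac)
  qed
  \<comment> \<open>The change of variables also transports absolute integrability, which lets the
    gauge integrals be read as Lebesgue integrals afterwards.\<close>
  have "(\<lambda>s. \<bar>?g' s\<bar> * ?f (?g s)) absolutely_integrable_on {0<..} \<and>
      integral {0<..} (\<lambda>s. \<bar>?g' s\<bar> * ?f (?g s)) = integral {0<..<1} ?f"
    using has_absolute_integral_change_of_variables_1'[OF _ der inj, of ?f "integral {0<..<1} ?f"] f img
    by simp
  then have h: "set_integrable lebesgue {0<..} ?h" "integral {0<..} ?h = integral {0<..<1} ?f"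
    using subst integral_cong[of "{0<..}" "\<lambda>s. \<bar>?g' s\<bar> * ?f (?g s)" ?h]
      set_integrable_cong[OF refl refl, of "{0<..}" "\<lambda>s. \<bar>?g' s\<bar> * ?f (?g s)" ?h] by auto
  have "(LINT t:{0<..<1}|lebesgue. ?f t) = (LINT s:{0<..}|lebesgue. ?h s)"
    using set_lebesgue_integral_eq_integral(2)[OF f] set_lebesgue_integral_eq_integral(2)[OF h(1)] h(2)
    by simp
  also have "\<dots> = Gamma (1 + \<alpha>) * (exp (- x) * tricomi_U (1 + \<alpha>) (1 - \<beta>) x)"
    using Gamma_real_pos[of "1 + \<alpha>"] assms by (simp add: tricomi_U_def order_less_imp_not_eq2)
  finally show ?thesis .
qed

text \<open>Ensures that \<open>ennreal\<close> in \<open>weighted_measure\<close> does not truncate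
  the weight. It covers every z, as a divergent Lebesgue integral has the value 0.\<close>

lemma tricomi_U_nonneg:
  assumes "a > 0" shows "tricomi_U a b z \<ge> 0"
  unfolding tricomi_U_def set_lebesgue_integral_def
  using Gamma_real_pos[OF assms]
  by (intro mult_nonneg_nonneg Bochner_Integration.integral_nonneg) (simp_all add: less_imp_le)

section \<open>The action of \<open>theta\<close> on Laplace means\<close>

text \<open>For p = 1 this is \<phi>. With the polynomial as a parameter the family is closed under
  \<open>theta\<close>, which acts on p as multiplication by x.\<close>

definition laplace_mean :: "(real \<Rightarrow> real) \<Rightarrow> real poly \<Rightarrow> real \<Rightarrow> real" where
  "laplace_mean \<psi> p t = 1 / t * (LINT x:{0<..}|lebesgue. exp (- x / t) * (poly p x * \<psi> x))"

context
  fixes \<psi> :: "real \<Rightarrow> real"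
  assumes moments: "\<And>k::nat. set_integrable lebesgue {0<..} (\<lambda>x. x ^ k * exp (- x) * \<psi> x)"
begin

lemma poly_moments: "set_integrable lebesgue {0<..} (\<lambda>x. exp (- x) * (poly p x * \<psi> x))"
proof -
  have "integrable lebesgue
      (\<lambda>x. \<Sum>k\<le>degree p. coeff p k * (indicator {0<..} x * (x ^ k * exp (- x) * \<psi> x)))"
    using moments by (auto simp: set_integrable_def)
  then show ?thesis
    by (simp add: set_integrable_def poly_altdef sum_distrib_left sum_distrib_right mult_ac)
qed

lemma has_field_derivative_laplace_mean:
  assumes "0 < t" "t < 1"
  shows "((\<lambda>s. s * laplace_mean \<psi> p s) has_field_derivative laplace_mean \<psi> (pCons 0 p) t / t) (at t)"
proof -
  have "((\<lambda>s. LINT x:{0<..}|lebesgue. exp (- x / s) * (poly p x * \<psi> x)) has_field_derivative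
      1 / t\<^sup>2 * (LINT x:{0<..}|lebesgue. exp (- x / t) * (x * (poly p x * \<psi> x)))) (at t)"
    using poly_moments[of p] poly_moments[of "pCons 0 p"] assms
    by (intro laplace_has_field_derivative) (auto simp: mult_ac)
  also have "1 / t\<^sup>2 * (LINT x:{0<..}|lebesgue. exp (- x / t) * (x * (poly p x * \<psi> x))) =
      laplace_mean \<psi> (pCons 0 p) t / t"
    by (simp add: laplace_mean_def power2_eq_square mult_ac)
  finally show ?thesis
    \<comment> \<open>The factor s cancels the prefactor 1/s for s > 0, leaving the bare
      integral.\<close>
    by (rule has_field_derivative_transform_within_open[of _ _ _ "{0<..}"])
       (use assms in \<open>auto simp: laplace_mean_def\<close>)
qed

text \<open>Differentiation is local and (0,1) is open, so agreement with a mean on (0,1) suffices.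
  This form permits iteration, since the iterates of \<open>theta\<close> are only identified
  there.\<close>

lemma theta_laplace_mean:
  assumes f: "\<And>t. t \<in> {0<..<1} \<Longrightarrow> f t = laplace_mean \<psi> p t" and t: "t \<in> {0<..<1}"
  shows "theta f t = laplace_mean \<psi> (pCons 0 p) t"
    and "(\<lambda>s. s * f s) differentiable (at t)"
proof -
  have "((\<lambda>s. s * f s) has_field_derivative laplace_mean \<psi> (pCons 0 p) t / t) (at t)"
    using has_field_derivative_laplace_mean[of t p] t f
    by (intro has_field_derivative_transform_within_open[of _ _ _ "{0<..<1}" "\<lambda>s. s * f s"]) auto
  then show "theta f t = laplace_mean \<psi> (pCons 0 p) t" "(\<lambda>s. s * f s) differentiable (at t)"
    using t by (auto simp: theta_def DERIV_imp_deriv real_differentiable_def)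
qed

lemma theta_funpow_laplace_mean:
  assumes f: "\<And>t. t \<in> {0<..<1} \<Longrightarrow> f t = laplace_mean \<psi> p t" and t: "t \<in> {0<..<1}"
  shows "(theta ^^ k) f t = laplace_mean \<psi> (monom 1 k * p) t"
  using t
proof (induction k arbitrary: t)
  case (Suc k)
  show ?case
    using theta_laplace_mean(1)[OF Suc.IH Suc.prems] by (simp add: monom_Suc)
qed (simp add: f monom_0 flip: one_pCons)

text \<open>Linearity of the integral over the powers of \<open>theta\<close>. A general p allows a
  second application, so that composing two operators multiplies their polynomials.\<close>

lemma poly_theta_laplace_mean:
  assumes f: "\<And>t. t \<in> {0<..<1} \<Longrightarrow> f t = laplace_mean \<psi> p t" and t: "t \<in> {0<..<1}"
  shows "poly_theta q f t = laplace_mean \<psi> (q * p) t"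
proof -
  have int: "set_integrable lebesgue {0<..} (\<lambda>x. exp (- x / t) * (poly r x * \<psi> x))" for r
    by (rule laplace_integrable[OF poly_moments]) (use t in auto)
  have theta: "(theta ^^ k) f t = laplace_mean \<psi> (monom 1 k * p) t" for k
    by (rule theta_funpow_laplace_mean[OF f t])
  let ?I = "\<lambda>k x. indicator {0<..} x * (exp (- x / t) * (poly (monom 1 k * p) x * \<psi> x))"
  have "poly_theta q f t = 1 / t * (\<Sum>k\<le>degree q. coeff q k * integral\<^sup>L lebesgue (?I k))"
    unfolding poly_theta_def theta laplace_mean_def
      set_lebesgue_integral_def real_scaleR_def sum_distrib_left
    by (intro sum.cong refl) (rule mult.left_commute)
  also have "(\<Sum>k\<le>degree q. coeff q k * integral\<^sup>L lebesgue (?I k)) =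
      (LINT x|lebesgue. (\<Sum>k\<le>degree q. coeff q k * ?I k x))"
    using int[unfolded set_integrable_def]
    by (subst Bochner_Integration.integral_sum) (simp_all del: poly_mult)
  also have "(\<lambda>x. \<Sum>k\<le>degree q. coeff q k * ?I k x) =
      (\<lambda>x. indicator {0<..} x *\<^sub>R (exp (- x / t) * (poly (q * p) x * \<psi> x)))"
    unfolding poly_mult poly_altdef[of q] poly_monom sum_distrib_left sum_distrib_right real_scaleR_def
    by (intro ext sum.cong refl) (simp only: mult_ac mult_1)
  finally show ?thesis
    by (simp add: laplace_mean_def set_lebesgue_integral_def)
qed

section \<open>Exchanging the integrals and passing to the weighted measure\<close>

lemma laplace_mean_Jacobi_integral:
  fixes \<alpha> \<beta> :: real
  assumes ab: "\<alpha> > -1" "\<beta> > 0"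
  shows "set_integrable lebesgue {0<..<1} (\<lambda>t. laplace_mean \<psi> p t * (1 - t) powr \<alpha> * t powr \<beta>)" (is ?int1)
    and "set_integrable lebesgue {0<..}
      (\<lambda>x. poly p x * (exp (- x) * tricomi_U (1 + \<alpha>) (1 - \<beta>) x * \<psi> x))" (is ?int2)
    and "(LINT t:{0<..<1}|lebesgue. laplace_mean \<psi> p t * (1 - t) powr \<alpha> * t powr \<beta>) =
      Gamma (1 + \<alpha>) * (LINT x:{0<..}|lebesgue.
        poly p x * (exp (- x) * tricomi_U (1 + \<alpha>) (1 - \<beta>) x * \<psi> x))" (is ?eq)
proof -
  \<comment> \<open>\<open>K\<close> already contains the prefactor 1/t. The indicators inside
    \<open>K\<close> and \<open>h\<close> turn the set integrals into integrals over the whole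
    line.\<close>
  define K where "K t = indicator {0<..<1} t * ((1 - t) powr \<alpha> * t powr (\<beta> - 1))" for t
  define h where "h x = indicator {0<..} x * (poly p x * \<psi> x)" for x
  define F where "F t x = (K t * exp (- x / t)) * h x" for t x
  interpret sigma_finite_measure "lebesgue :: real measure"
    by (rule sigma_finite_lebesgue)
  interpret pair_sigma_finite "lebesgue :: real measure" "lebesgue :: real measure" ..
  have K: "integrable lebesgue K"
    using jacobi_weight_integrable[OF ab] by (simp add: set_integrable_def K_def[abs_def])
  have H: "integrable lebesgue (\<lambda>x. exp (- x) * h x)"
    using poly_moments[of p] by (simp add: set_integrable_def h_def mult_ac)
  have h: "h \<in> borel_measurable lebesgue"
    unfolding h_def by (rule laplace_borel_measurable[OF poly_moments])
  have [measurable]: "K \<in> borel_measurable lebesgue" using K by auto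
  note [measurable] = h
  have id[measurable]: "(\<lambda>x. x) \<in> measurable (lebesgue :: real measure) borel"
    by (rule measurable_completion) simp
  have [measurable]: "fst \<in> borel_measurable ((lebesgue :: real measure) \<Otimes>\<^sub>M (lebesgue :: real measure))"
    using measurable_compose[OF measurable_fst id] by simp
  have [measurable]: "snd \<in> borel_measurable ((lebesgue :: real measure) \<Otimes>\<^sub>M (lebesgue :: real measure))"
    using measurable_compose[OF measurable_snd id] by simp
  \<comment> \<open>The majorant of \<open>F\<close> separates into a function of t times a function
    of x, so its integrability on the product follows from that of the factors.\<close>
  have "integrable (lebesgue \<Otimes>\<^sub>M lebesgue) (\<lambda>z. K (fst z) * (exp (- snd z) * h (snd z)))"
  proof (rule Fubini_integrable)
    show "integrable lebesgue (\<lambda>t. LINT x|lebesgue. norm (K (fst (t, x)) * (exp (- snd (t, x)) * h (snd (t, x)))))"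
      using K by (simp add: abs_mult)
    show "AE t in lebesgue. integrable lebesgue (\<lambda>x. K (fst (t, x)) * (exp (- snd (t, x)) * h (snd (t, x))))"
      using H by simp
  qed measurable
  then have "integrable (lebesgue \<Otimes>\<^sub>M lebesgue) (case_prod F)"
  proof (rule Bochner_Integration.integrable_bound)
    show "case_prod F \<in> borel_measurable (lebesgue \<Otimes>\<^sub>M lebesgue)"
      unfolding F_def case_prod_beta by measurable
    have "norm (F t x) \<le> norm (K t * (exp (- x) * h x))" for t x
    proof (cases "t \<in> {0<..<1} \<and> x > 0")
      case True
      then have "exp (- x / t) \<le> exp (- x)" by (simp add: field_simps)
      then have "\<bar>K t\<bar> * exp (- x / t) * \<bar>h x\<bar> \<le> \<bar>K t\<bar> * exp (- x) * \<bar>h x\<bar>"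
        by (intro mult_right_mono mult_left_mono) auto
      then show ?thesis by (simp add: F_def abs_mult mult_ac)
    qed (auto simp: F_def K_def h_def)
    then show "AE z in lebesgue \<Otimes>\<^sub>M lebesgue.
        norm (case_prod F z) \<le> norm (K (fst z) * (exp (- snd z) * h (snd z)))"
      by auto
  qed
  note F = integrable_fst[OF this] integrable_snd[OF this] Fubini_integral[OF this]
  have F1: "(LINT x|lebesgue. F t x) = indicator {0<..<1} t *\<^sub>R (laplace_mean \<psi> p t * (1 - t) powr \<alpha> * t powr \<beta>)" for t
  proof (cases "t \<in> {0<..<1}")
    case True
    have "(LINT x|lebesgue. F t x) = K t * (LINT x|lebesgue. exp (- x / t) * h x)"
      by (simp add: F_def[abs_def] mult.assoc)
    also have "(LINT x|lebesgue. exp (- x / t) * h x) = t * laplace_mean \<psi> p t"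
      using True by (simp add: laplace_mean_def h_def set_lebesgue_integral_def mult_ac)
    finally show ?thesis
      using True by (simp add: K_def powr_diff)
  qed (simp add: F_def[abs_def] K_def)
  have F2: "(LINT t|lebesgue. F t x) = Gamma (1 + \<alpha>) *
      (indicator {0<..} x *\<^sub>R (poly p x * (exp (- x) * tricomi_U (1 + \<alpha>) (1 - \<beta>) x * \<psi> x)))" for x
  proof (cases "x > 0")
    case True
    have "(LINT t|lebesgue. F t x) = (LINT t|lebesgue. K t * exp (- x / t)) * h x"
      by (simp add: F_def)
    also have "(LINT t|lebesgue. K t * exp (- x / t)) = Gamma (1 + \<alpha>) * (exp (- x) * tricomi_U (1 + \<alpha>) (1 - \<beta>) x)"
      using tricomi_U_Jacobi_integral[OF ab True] by (simp add: K_def set_lebesgue_integral_def mult_ac)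
    finally show ?thesis
      using True by (simp add: h_def mult_ac)
  qed (simp add: F_def h_def)
  show ?int1
    using F(1) by (simp add: F1 set_integrable_def)
  \<comment> \<open>Fubini gives integrability only with the factor \<Gamma>(1+\<alpha>) in front;
    as it is nonzero, it can be divided out.\<close>
  have G: "Gamma (1 + \<alpha>) \<noteq> 0"
    using Gamma_real_pos[of "1 + \<alpha>"] ab by linarith
  show ?int2
    using F(2) G by (simp add: F2 set_integrable_def)
  show ?eq
    using F(3) unfolding F1 F2 by (simp add: set_lebesgue_integral_def)
qed

lemma integral_weighted_measure_tricomi:
  fixes \<alpha> \<beta> :: real
  assumes ab: "\<alpha> > -1" "\<beta> > 0" and pos: "\<And>x. x > 0 \<Longrightarrow> \<psi> x \<ge> 0"
  shows "(LINT x|weighted_measure (\<lambda>x. exp (- x) * tricomi_U (1 + \<alpha>) (1 - \<beta>) x * \<psi> x). poly p x) =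
    (LINT x:{0<..}|lebesgue. poly p x * (exp (- x) * tricomi_U (1 + \<alpha>) (1 - \<beta>) x * \<psi> x))"
proof -
  let ?w = "\<lambda>x. exp (- x) * tricomi_U (1 + \<alpha>) (1 - \<beta>) x * \<psi> x"
  let ?M = "restrict_space lebesgue {0<..} :: real measure"
  \<comment> \<open>For p = 1 the integrand of the second Fubini conclusion is the weight itself, so
    its measurability comes without studying x-dependence of Tricomi's function.\<close>
  have "?w \<in> borel_measurable ?M"
    using laplace_mean_Jacobi_integral(2)[OF ab, of 1]
    by (auto simp: borel_measurable_restrict_space_iff set_integrable_def)
  moreover have "AE x in ?M. 0 \<le> ?w x"
    using pos tricomi_U_nonneg ab by (intro AE_I2) (auto simp: space_restrict_space)
  moreover have "poly p \<in> borel_measurable ?M"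
    by (intro measurable_restrict_space1 measurable_completion)
       (simp add: borel_measurable_continuous_onI continuous_at_imp_continuous_on)
  ultimately have "(LINT x|weighted_measure ?w. poly p x) = (LINT x|?M. ?w x *\<^sub>R poly p x)"
    unfolding weighted_measure_def by (intro integral_density)
  also have "\<dots> = (LINT x:{0<..}|lebesgue. poly p x * ?w x)"
    by (subst integral_restrict_space) (auto simp: set_lebesgue_integral_def mult_ac)
  finally show ?thesis .
qed

end

section \<open>Compositional orthogonality\<close>

theorem proposition3:
  fixes \<alpha> \<beta> :: real and \<phi> \<psi> :: "real \<Rightarrow> real" and P :: "nat \<Rightarrow> real poly"
  assumes "\<alpha> > -1" and "\<beta> > 0"
    and "\<And>t. t > 0 \<Longrightarrow> \<phi> t \<ge> 0"
    and "\<And>x. x > 0 \<Longrightarrow> \<psi> x \<ge> 0"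
    and "\<And>t. t > 0 \<Longrightarrow> \<phi> t = 1 / t * (LINT x:{0<..}|lebesgue. exp (- x / t) * \<psi> x)"
    and "\<And>k::nat. set_integrable lebesgue {0<..} (\<lambda>x. x ^ k * exp (- x) * \<psi> x)"
    and "orthogonal_polynomials
           (weighted_measure (\<lambda>x. exp (- x) * tricomi_U (1 + \<alpha>) (1 - \<beta>) x * \<psi> x)) P"
    and "\<And>n. Gamma (1 + \<alpha>) *
           (LINT x:{0<..}|lebesgue.
              poly (P n) x * poly (P n) x *
              (exp (- x) * tricomi_U (1 + \<alpha>) (1 - \<beta>) x * \<psi> x)) = 1"
  shows "(\<forall>k. \<forall>t\<in>{0<..<1}. (\<lambda>s. s * (theta ^^ k) \<phi> s) differentiable (at t)) \<and>
    (\<forall>n m.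
       set_integrable lebesgue {0<..<1}
         (\<lambda>t. poly_theta (P n) (poly_theta (P m) \<phi>) t * (1 - t) powr \<alpha> * t powr \<beta>) \<and>
       set_integrable lebesgue {0<..}
         (\<lambda>x. poly (P n) x * poly (P m) x *
              (exp (- x) * tricomi_U (1 + \<alpha>) (1 - \<beta>) x * \<psi> x)) \<and>
       (LINT t:{0<..<1}|lebesgue.
          poly_theta (P n) (poly_theta (P m) \<phi>) t * (1 - t) powr \<alpha> * t powr \<beta>) =
       Gamma (1 + \<alpha>) *
         (LINT x:{0<..}|lebesgue.
            poly (P n) x * poly (P m) x *
            (exp (- x) * tricomi_U (1 + \<alpha>) (1 - \<beta>) x * \<psi> x)) \<and>
       Gamma (1 + \<alpha>) *
         (LINT x:{0<..}|lebesgue.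
            poly (P n) x * poly (P m) x *
            (exp (- x) * tricomi_U (1 + \<alpha>) (1 - \<beta>) x * \<psi> x)) =
       (if n = m then 1 else 0))"
proof (intro conjI allI ballI)
  note ab = assms(1,2) and moments = assms(6)
  let ?w = "\<lambda>x. exp (- x) * tricomi_U (1 + \<alpha>) (1 - \<beta>) x * \<psi> x"
  have \<phi>: "\<phi> t = laplace_mean \<psi> 1 t" if "t \<in> {0<..<1}" for t
    using assms(5) that by (simp add: laplace_mean_def)
  \<comment> \<open>This makes every \<open>deriv\<close> inside the iterates a genuine derivative
    on (0,1), not an unspecified value.\<close>
  show "(\<lambda>s. s * (theta ^^ k) \<phi> s) differentiable (at t)" if "t \<in> {0<..<1}" for k t
    by (rule theta_laplace_mean(2)[OF moments theta_funpow_laplace_mean[OF moments \<phi>] that])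
  fix n m
  note J = laplace_mean_Jacobi_integral[OF moments ab, of "P n * P m", unfolded poly_mult]
  have PP: "poly_theta (P n) (poly_theta (P m) \<phi>) t = laplace_mean \<psi> (P n * P m) t"
    if "t \<in> {0<..<1}" for t
    using poly_theta_laplace_mean[OF moments poly_theta_laplace_mean[OF moments \<phi>] that] by simp
  show "set_integrable lebesgue {0<..<1}
      (\<lambda>t. poly_theta (P n) (poly_theta (P m) \<phi>) t * (1 - t) powr \<alpha> * t powr \<beta>)"
    using J(1) PP by (subst set_integrable_cong[OF refl refl]) auto
  show "set_integrable lebesgue {0<..} (\<lambda>x. poly (P n) x * poly (P m) x * ?w x)"
    by (rule J(2))
  show "(LINT t:{0<..<1}|lebesgue.
        poly_theta (P n) (poly_theta (P m) \<phi>) t * (1 - t) powr \<alpha> * t powr \<beta>) =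
      Gamma (1 + \<alpha>) * (LINT x:{0<..}|lebesgue. poly (P n) x * poly (P m) x * ?w x)"
    unfolding J(3)[symmetric] by (rule set_lebesgue_integral_cong) (auto simp: PP)
  show "Gamma (1 + \<alpha>) * (LINT x:{0<..}|lebesgue. poly (P n) x * poly (P m) x * ?w x) =
      (if n = m then 1 else 0)"
  proof (cases "n = m")
    case False
    \<comment> \<open>Orthogonality is stated for the density measure, so the off-diagonal case has
      to be carried back to the integral over the half-line.\<close>
    then have "(LINT x|weighted_measure ?w. poly (P n * P m) x) = 0"
      using assms(7) by (simp add: orthogonal_polynomials_def)
    then show ?thesis
      using False integral_weighted_measure_tricomi[OF moments ab assms(4), of "P n * P m"] by simp
  qed (use assms(8)[of n] in simp)
qed

end
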